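(* Given a finite set $\mathcal{P}$ of quasi-density properties and a modal formula $\varphi$, it is decidable whether $\varphi \in \mathsf{L}(\mathcal{P})$. That is, there is a computable function $f$ such that for every finite set $\mathcal{P}$ of quasi-density properties and every modal formula $\varphi$, $f(\mathsf{L}(\mathcal{P}),\varphi)=1$ if $\varphi\in\mathsf{L}(\mathcal{P})$ and $f(\mathsf{L}(\mathcal{P}),\varphi)=0$ otherwise.
   Context: Modal formulae are generated by $\varphi ::= p \mid \neg p \mid \varphi\lor\varphi \mid \varphi\land\varphi \mid \Diamond\varphi \mid \Box\varphi$, with $p$ ranging over a set of propositional atoms (negation normal form). A quasi-density property (QDP) is a first-order formula $\forall x,y\,(R^{k}(x,y)\rightarrow R^{n}(x,y))$ with $0<k<n$, where $R^0(x,y):=(x=y)$ and $R^{\ell+1}(x,y):=\exists z\,(R^{\ell}(x,z)\land R(z,y))$. For a finite set $\mathcal{P}$ of QDPs, a $\mathcal{P}$-model is a Kripke model $(W,R,V)$ ($W\neq\emptyset$, $R\subseteq W\times W$, $V$ a valuation of atoms to subsets of $W$) whose accessibility relation $R$ satisfies every property in $\mathcal{P}$. Truth at worlds is the standard Kripke semantics ($w\Vdash\neg p$ iff $w\notin V(p)$; $w\Vdash\Diamond\psi$ iff some $R$-successor satisfies $\psi$; $w\Vdash\Box\psi$ iff all $R$-successors satisfy $\psi$). A formula is $\mathcal{P}$-valid if it is true at every world of every $\mathcal{P}$-model, and $\mathsf{L}(\mathcal{P})$ is the set of $\mathcal{P}$-valid modal formulae (equivalently, $\mathsf{K}$ extended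 with the axioms $\Diamond^k p\to\Diamond^n p$). *)

theory Defs
  imports Main "HOL-Library.Nat_Bijection" "HOL-Library.Countable_Set"
begin

section \<open>Modal formulae and Kripke semantics\<close>

text \<open>The atoms form a countably infinite set, indexed by the natural numbers.\<close>

datatype fml =
    Atom nat
  | NegAtom nat
  | Or fml fml
  | And fml fml
  | Dia fml
  | Box fml

primrec sat :: "('w \<times> 'w) set \<Rightarrow> (nat \<Rightarrow> 'w set) \<Rightarrow> 'w \<Rightarrow> fml \<Rightarrow> bool" where
  "sat R V w (Atom p) \<longleftrightarrow> w \<in> V p"
| "sat R V w (NegAtom p) \<longleftrightarrow> w \<notin> V p"
| "sat R V w (Or \<phi> \<psi>) \<longleftrightarrow> sat R V w \<phi> \<or> sat R V w \<psi>"
| "sat R V w (And \<phi> \<psi>) \<longleftrightarrow> sat R V w \<phi> \<and> sat R V w \<psi>"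
| "sat R V w (Dia \<phi>) \<longleftrightarrow> (\<exists>v. (w, v) \<in> R \<and> sat R V v \<phi>)"
| "sat R V w (Box \<phi>) \<longleftrightarrow> (\<forall>v. (w, v) \<in> R \<longrightarrow> sat R V v \<phi>)"

section \<open>Quasi-density properties\<close>

text \<open>The pair (k, n) stands for the first-order sentence
  \<open>\<forall>x y. R\<^sup>k(x, y) \<longrightarrow> R\<^sup>n(x, y)\<close>.\<close>

type_synonym qdp = "nat \<times> nat"

definition is_qdp :: "qdp \<Rightarrow> bool" where
  "is_qdp q \<longleftrightarrow> 0 < fst q \<and> fst q < snd q"

definition satisfies_qdp :: "'w set \<Rightarrow> ('w \<times> 'w) set \<Rightarrow> qdp \<Rightarrow> bool" where
  "satisfies_qdp W R q \<longleftrightarrow>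
     (\<forall>x\<in>W. \<forall>y\<in>W. (x, y) \<in> R ^^ fst q \<longrightarrow> (x, y) \<in> R ^^ snd q)"

definition is_model ::
  "qdp set \<Rightarrow> 'w set \<Rightarrow> ('w \<times> 'w) set \<Rightarrow> (nat \<Rightarrow> 'w set) \<Rightarrow> bool" where
  "is_model P W R V \<longleftrightarrow>
     W \<noteq> {} \<and> R \<subseteq> W \<times> W \<and> (\<forall>p. V p \<subseteq> W) \<and> (\<forall>q\<in>P. satisfies_qdp W R q)"

definition valid_over :: "'w itself \<Rightarrow> qdp set \<Rightarrow> fml \<Rightarrow> bool" where
  "valid_over T P \<phi> \<longleftrightarrow>
     (\<forall>(W :: 'w set) R V. is_model P W R V \<longrightarrow> (\<forall>w\<in>W. sat R V w \<phi>))"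

text \<open>HOL cannot quantify over all types inside a definition, so the worlds are drawn from one
  fixed infinite type.  Theorem \<open>logic_sound\<close> below shows that nothing is lost:
  the formulae in \<open>logic P\<close> are true at all worlds of all P-models over every type
  (and \<open>logic_iff_valid_over\<close>: any other infinite type yields the same logic).\<close>

definition logic :: "qdp set \<Rightarrow> fml set" where
  "logic P = {\<phi>. valid_over TYPE(nat) P \<phi>}"

section \<open>Computable functions\<close>

text \<open>Programs of the partial recursive (mu-recursive) functions, with a big-step semantics:
  \<open>evaluates r xs y\<close> means that the program r halts on the arguments xs with the
  result y.\<close>

datatype recf =
    Zero
  | Succ
  | Proj nat
  | Comp recf "recf list"
  | PrimRec recf recf
  | Mu recf

inductive evaluates :: "recf \<Rightarrow> nat list \<Rightarrow> nat \<Rightarrow> bool" where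
  Zero: "evaluates Zero xs 0"
| Succ: "evaluates Succ [x] (Suc x)"
| Proj: "i < length xs \<Longrightarrow> evaluates (Proj i) xs (xs ! i)"
| Comp: "length ys = length gs \<Longrightarrow> (\<forall>i < length gs. evaluates (gs ! i) xs (ys ! i)) \<Longrightarrow>
    evaluates h ys z \<Longrightarrow> evaluates (Comp h gs) xs z"
| PrimRec_0: "evaluates g xs z \<Longrightarrow> evaluates (PrimRec g h) (0 # xs) z"
| PrimRec_Suc: "evaluates (PrimRec g h) (m # xs) v \<Longrightarrow> evaluates h (m # v # xs) z \<Longrightarrow>
    evaluates (PrimRec g h) (Suc m # xs) z"
| Mu: "(\<forall>m < n. \<exists>v. evaluates g (m # xs) (Suc v)) \<Longrightarrow> evaluates g (n # xs) 0 \<Longrightarrow>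
    evaluates (Mu g) xs n"

definition computable2 :: "(nat \<Rightarrow> nat \<Rightarrow> nat) \<Rightarrow> bool" where
  "computable2 f \<longleftrightarrow> (\<exists>r. \<forall>x y. evaluates r [x, y] (f x y))"

inductive_cases evaluates_ZeroE: "evaluates Zero xs y"
inductive_cases evaluates_SuccE: "evaluates Succ xs y"
inductive_cases evaluates_ProjE: "evaluates (Proj i) xs y"
inductive_cases evaluates_CompE: "evaluates (Comp h gs) xs y"
inductive_cases evaluates_PrimRec_0E: "evaluates (PrimRec g h) (0 # xs) y"
inductive_cases evaluates_PrimRec_SucE: "evaluates (PrimRec g h) (Suc m # xs) y"
inductive_cases evaluates_MuE: "evaluates (Mu g) xs y"

lemma evaluates_deterministic:
  assumes "evaluates r xs y" and "evaluates r xs z"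
  shows "y = z"
  using assms
proof (induction arbitrary: z rule: evaluates.induct)
  case (Zero xs)
  then show ?case by (rule evaluates_ZeroE) simp
next
  case (Succ x)
  then show ?case by (rule evaluates_SuccE) simp
next
  case (Proj i xs)
  from Proj.prems show ?case by (rule evaluates_ProjE) simp
next
  case (Comp ys gs xs h y)
  from Comp.prems obtain ys' where ys': "length ys' = length gs"
      "\<forall>i < length gs. evaluates (gs ! i) xs (ys' ! i)" "evaluates h ys' z"
    by (rule evaluates_CompE)
  have "ys = ys'"
    using Comp.IH(1) Comp.hyps(1) ys'(1,2) by (intro nth_equalityI) simp_all
  then show ?case using Comp.IH(2) ys'(3) by blast
next
  case (PrimRec_0 g xs y h)
  from PrimRec_0.prems have "evaluates g xs z" by (rule evaluates_PrimRec_0E)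
  then show ?case by (rule PrimRec_0.IH)
next
  case (PrimRec_Suc g h m xs v y)
  from PrimRec_Suc.prems obtain v' where
      v': "evaluates (PrimRec g h) (m # xs) v'" "evaluates h (m # v' # xs) z"
    by (rule evaluates_PrimRec_SucE)
  from PrimRec_Suc.IH(1)[OF v'(1)] v'(2) show ?case by (simp add: PrimRec_Suc.IH(2))
next
  case (Mu n g xs)
  from Mu.prems have z: "(\<forall>m < z. \<exists>v. evaluates g (m # xs) (Suc v))"
    by (rule evaluates_MuE)
  from Mu.prems have z0: "evaluates g (z # xs) 0" by (rule evaluates_MuE)
  have "\<not> z < n" using Mu.IH(1) z0 by blast
  moreover have "\<not> n < z" using Mu.IH(2) z by blast
  ultimately show ?case by simp
qed

section \<open>Encoding of the inputs as natural numbers\<close>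

primrec fml_code :: "fml \<Rightarrow> nat" where
  "fml_code (Atom p) = prod_encode (0, p)"
| "fml_code (NegAtom p) = prod_encode (1, p)"
| "fml_code (Or \<phi> \<psi>) = prod_encode (2, prod_encode (fml_code \<phi>, fml_code \<psi>))"
| "fml_code (And \<phi> \<psi>) = prod_encode (3, prod_encode (fml_code \<phi>, fml_code \<psi>))"
| "fml_code (Dia \<phi>) = prod_encode (4, fml_code \<phi>)"
| "fml_code (Box \<phi>) = prod_encode (5, fml_code \<phi>)"

text \<open>Meaningful for finite sets only, as is \<^const>\<open>set_encode\<close>.\<close>

definition qdps_code :: "qdp set \<Rightarrow> nat" where
  "qdps_code P = set_encode (prod_encode ` P)"

lemma inj_fml_code: "inj fml_code"
proof (rule injI)
  show "fml_code \<phi> = fml_code \<psi> \<Longrightarrow> \<phi> = \<psi>" for \<phi> \<psi>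
    by (induction \<phi> arbitrary: \<psi>; case_tac \<psi>) (auto simp: prod_encode_eq)
qed

lemma inj_on_qdps_code: "inj_on qdps_code {P. finite P}"
proof (rule inj_onI, clarify)
  fix P Q :: "qdp set"
  assume fin: "finite P" "finite Q" and "qdps_code P = qdps_code Q"
  then have "prod_encode ` P = prod_encode ` Q"
    unfolding qdps_code_def by (metis finite_imageI set_encode_inverse)
  then show "P = Q" by (simp add: inj_image_eq_iff inj_prod_encode)
qed

section \<open>Independence of the type of worlds\<close>

lemma sat_image:
  assumes R: "R \<subseteq> W \<times> W" and V: "\<forall>p. V p \<subseteq> W" and g: "inj_on g W" and "w \<in> W"
  shows "sat (map_prod g g ` R) (\<lambda>p. g ` V p) (g w) \<phi> \<longleftrightarrow> sat R V w \<phi>"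
  using \<open>w \<in> W\<close>
proof (induction \<phi> arbitrary: w)
  case (Atom p)
  then show ?case using V g by (auto dest: inj_onD)
next
  case (NegAtom p)
  then show ?case using V g by (auto dest: inj_onD)
next
  case (Dia \<phi>)
  have "(\<exists>v. (g w, v) \<in> map_prod g g ` R \<and> Q v) \<longleftrightarrow> (\<exists>v. (w, v) \<in> R \<and> Q (g v))" for Q
    using R g Dia.prems by (fastforce dest: inj_onD)
  then show ?case using Dia.IH R by auto
next
  case (Box \<phi>)
  have "(\<forall>v. (g w, v) \<in> map_prod g g ` R \<longrightarrow> Q v) \<longleftrightarrow> (\<forall>v. (w, v) \<in> R \<longrightarrow> Q (g v))" for Q
    using R g Box.prems by (fastforce dest: inj_onD)
  then show ?case using Box.IH R by auto
qed auto

lemma relpow_image: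
  assumes "(x, y) \<in> R ^^ n"
  shows "(g x, g y) \<in> (map_prod g g ` R) ^^ n"
  using assms
proof (induction n arbitrary: y)
  case (Suc n)
  then obtain z where "(x, z) \<in> R ^^ n" "(z, y) \<in> R" by auto
  then show ?case using Suc.IH by (auto intro!: relcompI[of _ "g z"])
qed simp

lemma relpow_image_D:
  assumes R: "R \<subseteq> W \<times> W" and g: "inj_on g W" and x: "x \<in> W"
    and "(g x, y') \<in> (map_prod g g ` R) ^^ n"
  shows "\<exists>y\<in>W. y' = g y \<and> (x, y) \<in> R ^^ n"
  using assms(4)
proof (induction n arbitrary: y')
  case 0
  then show ?case using x by auto
next
  case (Suc n)
  then obtain z' where "(g x, z') \<in> (map_prod g g ` R) ^^ n" and z': "(z', y') \<in> map_prod g g ` R"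
    by auto
  with Suc.IH obtain z where z: "z \<in> W" "z' = g z" "(x, z) \<in> R ^^ n" by blast
  from z' obtain a b where ab: "(a, b) \<in> R" "z' = g a" "y' = g b" by auto
  then have "a = z" using z R g by (auto dest: inj_onD)
  then show ?case using ab z R by auto
qed

lemma is_model_image:
  assumes m: "is_model P W R V" and g: "inj_on g W"
  shows "is_model P (g ` W) (map_prod g g ` R) (\<lambda>p. g ` V p)"
proof -
  have R: "R \<subseteq> W \<times> W" using m by (simp add: is_model_def)
  have "satisfies_qdp (g ` W) (map_prod g g ` R) q" if "q \<in> P" for q
    unfolding satisfies_qdp_def
  proof clarify
    fix x y assume xy: "x \<in> W" "y \<in> W" "(g x, g y) \<in> (map_prod g g ` R) ^^ fst q"
    with relpow_image_D[OF R g] obtain z where z: "z \<in> W" "g y = g z" "(x, z) \<in> R ^^ fst q"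
      by blast
    then have "y = z" using xy g by (auto dest: inj_onD)
    then have "(x, y) \<in> R ^^ snd q"
      using m that xy z by (auto simp: is_model_def satisfies_qdp_def)
    then show "(g x, g y) \<in> (map_prod g g ` R) ^^ snd q" by (rule relpow_image)
  qed
  moreover have "map_prod g g ` R \<subseteq> g ` W \<times> g ` W" using R by auto
  moreover have "g ` W \<noteq> {}" "\<forall>p. g ` V p \<subseteq> g ` W" using m by (auto simp: is_model_def image_mono)
  ultimately show ?thesis by (simp add: is_model_def)
qed

lemma valid_over_inj:
  assumes "valid_over TYPE('a) P \<phi>" and m: "is_model P W R V" and w: "w \<in> W"
    and g: "inj_on (g :: 'w \<Rightarrow> 'a) W"
  shows "sat R V w \<phi>"
proof -
  have "sat (map_prod g g ` R) (\<lambda>p. g ` V p) (g w) \<phi>"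
    using assms(1) is_model_image[OF m g] w unfolding valid_over_def by blast
  then show ?thesis using sat_image[of R W V g w \<phi>] m w g by (auto simp: is_model_def)
qed

text \<open>Downward Loewenheim-Skolem argument: U collects witnesses for diamonds and for all
  intermediate points of paths, starting from the world w.\<close>

lemma countable_submodel:
  fixes R :: "('w \<times> 'w) set"
  assumes m: "is_model P W R V" and w: "w \<in> W"
  obtains U where "countable U" "w \<in> U" "is_model P U (R \<inter> U \<times> U) (\<lambda>p. V p \<inter> U)"
    and "\<And>u \<phi>. u \<in> U \<Longrightarrow> sat (R \<inter> U \<times> U) (\<lambda>p. V p \<inter> U) u \<phi> \<longleftrightarrow> sat R V u \<phi>"
proof -
  have R: "R \<subseteq> W \<times> W" using m by (simp add: is_model_def)
  define wit where "wit u \<phi> =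
    (if \<exists>v. (u, v) \<in> R \<and> sat R V v \<phi> then SOME v. (u, v) \<in> R \<and> sat R V v \<phi> else u)" for u \<phi>
  define mid where "mid a b n =
    (if \<exists>z. (a, z) \<in> R ^^ n \<and> (z, b) \<in> R then SOME z. (a, z) \<in> R ^^ n \<and> (z, b) \<in> R else a)"
    for a b n
  have wit: "(u, wit u \<phi>) \<in> R \<and> sat R V (wit u \<phi>) \<phi>" if "(u, v) \<in> R" "sat R V v \<phi>" for u v \<phi>
  proof -
    have "\<exists>v. (u, v) \<in> R \<and> sat R V v \<phi>" using that by blast
    from someI_ex[OF this] this show ?thesis by (simp add: wit_def)
  qed
  have mid: "(a, mid a b n) \<in> R ^^ n \<and> (mid a b n, b) \<in> R" if "(a, b) \<in> R ^^ Suc n" for a b n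
  proof -
    have "\<exists>z. (a, z) \<in> R ^^ n \<and> (z, b) \<in> R" using that by auto
    from someI_ex[OF this] this show ?thesis by (simp add: mid_def)
  qed
  have wit_W: "wit u \<phi> \<in> W" if "u \<in> W" for u \<phi>
    using wit[of u _ \<phi>] R that by (cases "\<exists>v. (u, v) \<in> R \<and> sat R V v \<phi>") (auto simp: wit_def)
  have mid_W: "mid a b n \<in> W" if "a \<in> W" for a b n
  proof (cases "\<exists>z. (a, z) \<in> R ^^ n \<and> (z, b) \<in> R")
    case True
    then have "(a, b) \<in> R ^^ Suc n" by auto
    then show ?thesis using mid[of a b n] R by auto
  next
    case False
    then have "mid a b n = a" unfolding mid_def by (rule if_not_P)
    then show ?thesis using that by simp
  qed
  define step where "step A = A \<union> (\<Union>u\<in>A. range (wit u)) \<union> (\<Union>a\<in>A. \<Union>b\<in>A. range (mid a b))" for A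
  define S where "S i = (step ^^ i) {w}" for i
  define U where "U = (\<Union>i. S i)"
  have S_Suc: "S (Suc i) = step (S i)" for i by (simp add: S_def)
  have "countable (UNIV :: fml set)" using inj_fml_code by (rule countableI)
  then have cnt_wit: "countable (range (wit u))" for u by simp
  have "countable (S i)" for i
  proof (induction i)
    case (Suc i)
    then show ?case unfolding S_Suc step_def by (intro countable_Un countable_UN cnt_wit) simp_all
  qed (simp add: S_def)
  then have cU: "countable U" by (simp add: U_def)
  have "S 0 = {w}" by (simp add: S_def)
  then have wU: "w \<in> U" by (force simp: U_def)
  have "S i \<subseteq> W" for i
  proof (induction i)
    case (Suc i)
    then show ?case using wit_W mid_W unfolding S_Suc step_def by blast
  qed (use w \<open>S 0 = {w}\<close> in simp)
  then have UW: "U \<subseteq> W" by (auto simp: U_def)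
  have S_mono: "S i \<subseteq> S j" if "i \<le> j" for i j
    using that by (rule lift_Suc_mono_le[of S, rotated]) (unfold S_Suc step_def, blast)
  have wit_U: "wit u \<phi> \<in> U" if "u \<in> U" for u \<phi>
  proof -
    from that obtain i where "u \<in> S i" by (auto simp: U_def)
    then have "wit u \<phi> \<in> S (Suc i)" unfolding S_Suc step_def by blast
    then show ?thesis unfolding U_def by blast
  qed
  have mid_U: "mid a b n \<in> U" if "a \<in> U" "b \<in> U" for a b n
  proof -
    from that obtain i j where "a \<in> S i" "b \<in> S j" unfolding U_def by (elim UN_E)
    then have "a \<in> S (max i j)" "b \<in> S (max i j)"
      using S_mono[OF max.cobounded1] S_mono[OF max.cobounded2] by blast+
    then have "mid a b n \<in> S (Suc (max i j))"
      unfolding S_Suc step_def by (intro UnI2 UN_I[of a] UN_I[of b] rangeI)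
    then show ?thesis unfolding U_def by blast
  qed
  have path: "(a, b) \<in> (R \<inter> U \<times> U) ^^ n" if "a \<in> U" "b \<in> U" "(a, b) \<in> R ^^ n" for a b n
    using that
  proof (induction n arbitrary: b)
    case (Suc n)
    let ?z = "mid a b n"
    have z: "?z \<in> U" using Suc.prems(1,2) by (rule mid_U)
    have "(a, ?z) \<in> (R \<inter> U \<times> U) ^^ n"
      using Suc.prems(1) z conjunct1[OF mid[OF Suc.prems(3)]] by (rule Suc.IH)
    moreover have "(?z, b) \<in> R \<inter> U \<times> U" using mid[OF Suc.prems(3)] z Suc.prems(2) by simp
    ultimately show ?case by auto
  qed simp
  have sub: "(a, b) \<in> R ^^ n" if "(a, b) \<in> (R \<inter> U \<times> U) ^^ n" for a b n
    using that by (induction n arbitrary: b) auto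
  have "satisfies_qdp U (R \<inter> U \<times> U) q" if "q \<in> P" for q
    unfolding satisfies_qdp_def
  proof (intro ballI impI)
    fix x y assume xy: "x \<in> U" "y \<in> U" "(x, y) \<in> (R \<inter> U \<times> U) ^^ fst q"
    then have "(x, y) \<in> R ^^ fst q" by (blast intro: sub)
    then have "(x, y) \<in> R ^^ snd q"
      using m that xy UW unfolding is_model_def satisfies_qdp_def by blast
    then show "(x, y) \<in> (R \<inter> U \<times> U) ^^ snd q" using xy path by blast
  qed
  moreover have "U \<noteq> {}" using wU by blast
  ultimately have "is_model P U (R \<inter> U \<times> U) (\<lambda>p. V p \<inter> U)" by (simp add: is_model_def)
  from cU wU this show thesis
  proof (rule that)
    show "sat (R \<inter> U \<times> U) (\<lambda>p. V p \<inter> U) u \<phi> \<longleftrightarrow> sat R V u \<phi>" if "u \<in> U" for u \<phi>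
      using that
    proof (induction \<phi> arbitrary: u)
      case (Dia \<phi>)
      have "(\<exists>v. (u, v) \<in> R \<and> sat R V v \<phi>) \<longleftrightarrow> (\<exists>v\<in>U. (u, v) \<in> R \<and> sat R V v \<phi>)"
        using wit wit_U[OF Dia.prems] by blast
      then show ?case using Dia by auto
    next
      case (Box \<phi>)
      have neg: "\<exists>\<psi>. \<forall>v. sat R V v \<psi> \<longleftrightarrow> \<not> sat R V v \<phi>"
      proof (induction \<phi>)
        case (Atom p) show ?case by (rule exI[of _ "NegAtom p"]) simp
      next
        case (NegAtom p) show ?case by (rule exI[of _ "Atom p"]) simp
      next
        case (Or \<phi>1 \<phi>2)
        then obtain \<psi>1 \<psi>2 where "\<forall>v. sat R V v \<psi>1 \<longleftrightarrow> \<not> sat R V v \<phi>1"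
          "\<forall>v. sat R V v \<psi>2 \<longleftrightarrow> \<not> sat R V v \<phi>2" by blast
        then show ?case by (intro exI[of _ "And \<psi>1 \<psi>2"]) simp
      next
        case (And \<phi>1 \<phi>2)
        then obtain \<psi>1 \<psi>2 where "\<forall>v. sat R V v \<psi>1 \<longleftrightarrow> \<not> sat R V v \<phi>1"
          "\<forall>v. sat R V v \<psi>2 \<longleftrightarrow> \<not> sat R V v \<phi>2" by blast
        then show ?case by (intro exI[of _ "Or \<psi>1 \<psi>2"]) simp
      next
        case (Dia \<phi>)
        then obtain \<psi> where "\<forall>v. sat R V v \<psi> \<longleftrightarrow> \<not> sat R V v \<phi>" by blast
        then show ?case by (intro exI[of _ "Box \<psi>"]) simp
      next
        case (Box \<phi>)
        then obtain \<psi> where "\<forall>v. sat R V v \<psi> \<longleftrightarrow> \<not> sat R V v \<phi>" by blast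
        then show ?case by (intro exI[of _ "Dia \<psi>"]) simp
      qed
      then obtain \<psi> where \<psi>: "\<forall>v. sat R V v \<psi> \<longleftrightarrow> \<not> sat R V v \<phi>" by blast
      have "(\<forall>v. (u, v) \<in> R \<longrightarrow> sat R V v \<phi>) \<longleftrightarrow> (\<forall>v\<in>U. (u, v) \<in> R \<longrightarrow> sat R V v \<phi>)"
        using wit[of u _ \<psi>] wit_U[OF Box.prems, of \<psi>] \<psi> by blast
      then show ?case using Box by auto
    qed auto
  qed
qed

theorem logic_sound:
  fixes W :: "'w set"
  assumes "\<phi> \<in> logic P" and m: "is_model P W R V" and w: "w \<in> W"
  shows "sat R V w \<phi>"
proof -
  obtain U where U: "countable U" "w \<in> U" "is_model P U (R \<inter> U \<times> U) (\<lambda>p. V p \<inter> U)"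
    "\<And>u \<psi>. u \<in> U \<Longrightarrow> sat (R \<inter> U \<times> U) (\<lambda>p. V p \<inter> U) u \<psi> \<longleftrightarrow> sat R V u \<psi>"
    using countable_submodel[OF m w] by metis
  have "valid_over TYPE(nat) P \<phi>" using assms(1) by (simp add: logic_def)
  then have "sat (R \<inter> U \<times> U) (\<lambda>p. V p \<inter> U) w \<phi>"
    using U(3) U(2) inj_on_to_nat_on[OF U(1)] by (rule valid_over_inj)
  then show ?thesis using U(4)[OF U(2)] by simp
qed

theorem logic_iff_valid_over:
  assumes "infinite (UNIV :: 'w set)"
  shows "\<phi> \<in> logic P \<longleftrightarrow> valid_over TYPE('w) P \<phi>"
proof
  assume "\<phi> \<in> logic P"
  then show "valid_over TYPE('w) P \<phi>"
    unfolding valid_over_def by (intro allI impI ballI) (rule logic_sound)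
next
  obtain g :: "nat \<Rightarrow> 'w" where g: "inj g" using infinite_countable_subset[OF assms] by blast
  assume valid: "valid_over TYPE('w) P \<phi>"
  have "sat R V w \<phi>" if "is_model P W R V" "w \<in> W" for W :: "nat set" and R V w
    using valid that inj_on_subset[OF g subset_UNIV] by (rule valid_over_inj)
  then show "\<phi> \<in> logic P" by (simp add: logic_def valid_over_def)
qed

end

(* The logics have the finite model property.  Given a countermodel (W, R, V) to a formula of modal
   depth at most d, take the worlds (m, x) with m <= d, where m is the modal depth up to which x still
   matters.  There is an edge from (m, x) to (n, y) iff m = 0, or m - 1 <= n and x has an R-successor
   that is bisimilar to y up to depth m - 1.  A path of length k from (m, x) with k <= m projects to an
   R-path whose end is bisimilar up to depth m - k to the end of the given path.  Quasi-density
   lengthens the R-path, and it lifts back because k < n makes the requirement on the last edge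
   only weaker.  A path with k > m passes level 0, from where every world can be reached in
   any positive number of steps.  Identifying (m, x) and (m, y) for x, y bisimilar up to depth m leaves
   finitely many worlds, with a recursive bound, so that a bounded search decides validity. *)

theory Submission
  imports Defs
begin

section \<open>Total recursive functions of fixed arity and their closure properties\<close>

section \<open>Recursive functions\<close>

text \<open>Argument lists act as environments in the style of de Bruijn: a variable is
  \<open>hd\<close> after some number of \<open>tl\<close>, so that the closure rules below follow
  the syntax of a term.\<close>

definition computable :: "nat \<Rightarrow> (nat list \<Rightarrow> nat) \<Rightarrow> bool" where
  "computable n F \<longleftrightarrow> (\<exists>r. \<forall>xs. length xs = n \<longrightarrow> evaluates r xs (F xs))"

definition decidable :: "nat \<Rightarrow> (nat list \<Rightarrow> bool) \<Rightarrow> bool" where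
  "decidable n P \<longleftrightarrow> computable n (\<lambda>xs. of_bool (P xs))"

lemma computable_hd: "computable (Suc n) hd"
proof -
  have "evaluates (Proj 0) xs (hd xs)" if "length xs = Suc n" for xs
    using evaluates.Proj[of 0 xs] that by (cases xs) auto
  then show ?thesis unfolding computable_def by blast
qed

text \<open>Weakening past one bound variable: the program is precomposed with the projections to
  the positions after the first.\<close>

lemma computable_tl:
  assumes "computable n F"
  shows "computable (Suc n) (\<lambda>xs. F (tl xs))"
proof -
  obtain f where f: "\<And>xs. length xs = n \<Longrightarrow> evaluates f xs (F xs)"
    using assms unfolding computable_def by blast
  have "evaluates (Comp f (map Proj [1..<Suc n])) xs (F (tl xs))" if xs: "length xs = Suc n" for xs
  proof (rule evaluates.Comp[of "tl xs"])
    show "\<forall>i < length (map Proj [1..<Suc n]). evaluates (map Proj [1..<Suc n] ! i) xs (tl xs ! i)"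
      using evaluates.Proj[of "Suc _" xs] xs by (auto simp: nth_tl simp del: upt_Suc)
  qed (use f xs in auto)
  then show ?thesis unfolding computable_def by blast
qed

text \<open>Seven positions suffice for the two inputs, the table, and at most four nested
  quantifiers inside \<open>refutation_table\<close>.\<close>

lemmas computable_var =
  computable_hd
  computable_hd[THEN computable_tl]
  computable_hd[THEN computable_tl, THEN computable_tl]
  computable_hd[THEN computable_tl, THEN computable_tl, THEN computable_tl]
  computable_hd[THEN computable_tl, THEN computable_tl, THEN computable_tl, THEN computable_tl]
  computable_hd[THEN computable_tl, THEN computable_tl, THEN computable_tl, THEN computable_tl,
    THEN computable_tl]
  computable_hd[THEN computable_tl, THEN computable_tl, THEN computable_tl, THEN computable_tl,
    THEN computable_tl, THEN computable_tl]

lemma computable_Suc: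
  assumes "computable n A"
  shows "computable n (\<lambda>xs. Suc (A xs))"
proof -
  obtain a where a: "\<And>xs. length xs = n \<Longrightarrow> evaluates a xs (A xs)"
    using assms unfolding computable_def by blast
  have "evaluates (Comp Succ [a]) xs (Suc (A xs))" if "length xs = n" for xs
    by (rule evaluates.Comp[of "[A xs]"]) (use a[OF that] evaluates.Succ in auto)
  then show ?thesis unfolding computable_def by blast
qed

lemma computable_const: "computable n (\<lambda>xs. k)"
proof (induction k)
  case 0
  show ?case unfolding computable_def using evaluates.Zero by blast
next
  case (Suc k)
  then show ?case by (rule computable_Suc)
qed

text \<open>\<open>PrimRec\<close> recurses on its first argument. Putting the value of
  \<open>A\<close> in front of all projections lets the recursion run up to any computable bound
  while the whole list stays available as parameters.\<close>

lemma computable_rec_nat: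
  assumes "computable n A" and "computable n G"
    and "computable (Suc (Suc n)) (\<lambda>ys. H (hd ys) (hd (tl ys)) (tl (tl ys)))"
  shows "computable n (\<lambda>xs. rec_nat (G xs) (\<lambda>m v. H m v xs) (A xs))"
proof -
  obtain a where a: "\<And>xs. length xs = n \<Longrightarrow> evaluates a xs (A xs)"
    using assms(1) unfolding computable_def by blast
  obtain g where g: "\<And>xs. length xs = n \<Longrightarrow> evaluates g xs (G xs)"
    using assms(2) unfolding computable_def by blast
  obtain h where h: "\<And>ys. length ys = Suc (Suc n) \<Longrightarrow>
      evaluates h ys (H (hd ys) (hd (tl ys)) (tl (tl ys)))"
    using assms(3) unfolding computable_def by blast
  have rec: "evaluates (PrimRec g h) (m # xs) (rec_nat (G xs) (\<lambda>m v. H m v xs) m)"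
    if "length xs = n" for m xs
  proof (induction m)
    case 0
    show ?case using g[OF that] by (simp add: evaluates.PrimRec_0)
  next
    case (Suc m)
    then show ?case using h[of "m # _ # xs"] that by (auto intro: evaluates.PrimRec_Suc)
  qed
  have "evaluates (Comp (PrimRec g h) (a # map Proj [0..<n])) xs
      (rec_nat (G xs) (\<lambda>m v. H m v xs) (A xs))" if xs: "length xs = n" for xs
  proof (rule evaluates.Comp[of "A xs # xs"])
    show "\<forall>i < length (a # map Proj [0..<n]).
        evaluates ((a # map Proj [0..<n]) ! i) xs ((A xs # xs) ! i)"
      using a[OF xs] xs by (auto simp: nth_Cons' intro: evaluates.Proj)
  qed (use rec[OF xs] xs in auto)
  then show ?thesis unfolding computable_def by blast
qed

text \<open>The step function of a recursion receives counter, previous value and parameters. This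
  adapts a program that knows nothing of the previous value, such as the body of a bounded
  quantifier.\<close>

lemma computable_skip:
  assumes "computable (Suc n) (\<lambda>ys. F (hd ys) (tl ys))"
  shows "computable (Suc (Suc n)) (\<lambda>ys. F (hd ys) (tl (tl ys)))"
proof -
  obtain f where f: "\<And>ys. length ys = Suc n \<Longrightarrow> evaluates f ys (F (hd ys) (tl ys))"
    using assms unfolding computable_def by blast
  have "evaluates (Comp f (Proj 0 # map Proj [2..<Suc (Suc n)])) ys (F (hd ys) (tl (tl ys)))"
    if len: "length ys = Suc (Suc n)" for ys
  proof -
    obtain m v xs where ys: "ys = m # v # xs" and xs: "length xs = n"
      using len by (cases ys; cases "tl ys") auto
    show ?thesis
    proof (rule evaluates.Comp[of "m # xs"])
      show "\<forall>i < length (Proj 0 # map Proj [2..<Suc (Suc n)]).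
          evaluates ((Proj 0 # map Proj [2..<Suc (Suc n)]) ! i) ys ((m # xs) ! i)"
      proof (intro allI impI)
        fix i
        assume i: "i < length (Proj 0 # map Proj [2..<Suc (Suc n)])"
        show "evaluates ((Proj 0 # map Proj [2..<Suc (Suc n)]) ! i) ys ((m # xs) ! i)"
        proof (cases i)
          case 0
          then show ?thesis using evaluates.Proj[of 0 ys] ys by simp
        next
          case (Suc j)
          then show ?thesis
            using evaluates.Proj[of "Suc (Suc j)" ys] i xs ys by (simp del: upt_Suc)
        qed
      qed
      show "length (m # xs) = length (Proj 0 # map Proj [2..<Suc (Suc n)])"
        using xs by (simp del: upt_Suc)
      show "evaluates f (m # xs) (F (hd ys) (tl (tl ys)))"
        using f[of "m # xs"] xs ys by simp
    qed
  qed
  then show ?thesis unfolding computable_def by blast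
qed

section \<open>Arithmetic and the pairing function\<close>

lemma computable_add:
  assumes "computable n A" and "computable n B"
  shows "computable n (\<lambda>xs. A xs + B xs)"
proof -
  have "a + b = rec_nat b (\<lambda>_. Suc) a" for a b :: nat
    by (induction a) simp_all
  then show ?thesis
    by (simp only:) (intro computable_rec_nat computable_Suc computable_var assms)
qed

lemma computable_mult:
  assumes "computable n A" and "computable n B"
  shows "computable n (\<lambda>xs. A xs * B xs)"
proof -
  have "a * b = rec_nat 0 (\<lambda>_ v. v + b) a" for a b :: nat
    by (induction a) simp_all
  then show ?thesis
    by (simp only:) (intro computable_rec_nat computable_add computable_const computable_var
      assms assms(2)[THEN computable_tl, THEN computable_tl])
qed

lemma computable_power2:
  assumes "computable n A"
  shows "computable n (\<lambda>xs. 2 ^ A xs)"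
proof -
  have "(2 :: nat) ^ a = rec_nat 1 (\<lambda>_ v. 2 * v) a" for a
    by (induction a) simp_all
  then show ?thesis
    by (simp only:) (intro computable_rec_nat computable_mult computable_const computable_var assms)
qed

lemma computable_diff:
  assumes "computable n A" and "computable n B"
  shows "computable n (\<lambda>xs. A xs - B xs)"
proof -
  \<comment> \<open>Truncated subtraction iterates the predecessor, which is itself the recursion
    that returns its counter.\<close>
  have "a - b = rec_nat a (\<lambda>_. rec_nat 0 (\<lambda>m _. m)) b" for a b :: nat
  proof (induction b)
    case (Suc b)
    have "c - 1 = rec_nat 0 (\<lambda>m _. m) c" for c :: nat
      by (cases c) simp_all
    from this[of "a - b"] show ?case using Suc by simp
  qed simp
  then show ?thesis
    by (simp only:) (intro computable_rec_nat computable_const computable_var assms)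
qed

lemma computable_div2:
  assumes "computable n A"
  shows "computable n (\<lambda>xs. A xs div 2)"
proof -
  have "a div 2 = rec_nat 0 (\<lambda>m v. m - v) a" for a :: nat
  proof (induction a)
    case (Suc a)
    \<comment> \<open>This identity yields a recursion for halving without a case distinction on
      parity.\<close>
    have "Suc a div 2 = a - a div 2" by presburger
    then show ?case by (simp only: Suc.IH[symmetric] nat.rec(2))
  qed simp
  then show ?thesis
    by (simp only:) (intro computable_rec_nat computable_diff computable_const computable_var assms)
qed

lemma computable_div_power2:
  assumes "computable n A" and "computable n B"
  shows "computable n (\<lambda>xs. A xs div 2 ^ B xs)"
proof -
  have "a div 2 ^ b = rec_nat a (\<lambda>_ v. v div 2) b" for a b :: nat
  proof (induction b)
    case (Suc b)
    have "a div 2 ^ Suc b = a div 2 ^ b div 2"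
      by (simp only: power_Suc2 div_mult2_eq)
    then show ?case by (simp only: Suc.IH nat.rec(2))
  qed simp
  then show ?thesis
    by (simp only:) (intro computable_rec_nat computable_div2 computable_var assms)
qed

lemma computable_prod_encode:
  assumes "computable n A" and "computable n B"
  shows "computable n (\<lambda>xs. prod_encode (A xs, B xs))"
  unfolding prod_encode_def triangle_def split
  by (intro computable_div2 computable_mult computable_add computable_Suc assms)

section \<open>Decidable predicates and bounded quantifiers\<close>

lemma decidable_not:
  assumes "decidable n P"
  shows "decidable n (\<lambda>xs. \<not> P xs)"
proof -
  have "of_bool (\<not> p) = 1 - (of_bool p :: nat)" for p
    by simp
  then show ?thesis
    using assms unfolding decidable_def
    by (simp only:) (intro computable_diff computable_const)
qed

lemma decidable_conj:
  assumes "decidable n P" and "decidable n Q"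
  shows "decidable n (\<lambda>xs. P xs \<and> Q xs)"
  using assms unfolding decidable_def of_bool_conj by (rule computable_mult)

lemma decidable_disj:
  assumes "decidable n P" and "decidable n Q"
  shows "decidable n (\<lambda>xs. P xs \<or> Q xs)"
proof -
  have "decidable n (\<lambda>xs. \<not> (\<not> P xs \<and> \<not> Q xs))"
    by (intro decidable_not decidable_conj assms)
  then show ?thesis by simp
qed

lemma decidable_imp:
  assumes "decidable n P" and "decidable n Q"
  shows "decidable n (\<lambda>xs. P xs \<longrightarrow> Q xs)"
  unfolding imp_conv_disj by (intro decidable_disj decidable_not assms)

lemma decidable_iff:
  assumes "decidable n P" and "decidable n Q"
  shows "decidable n (\<lambda>xs. P xs \<longleftrightarrow> Q xs)"
  unfolding iff_conv_conj_imp by (intro decidable_conj decidable_imp assms)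

lemma decidable_le:
  assumes "computable n A" and "computable n B"
  shows "decidable n (\<lambda>xs. A xs \<le> B xs)"
proof -
  have "of_bool (a \<le> b) = 1 - (a - b)" for a b :: nat
    by simp
  then show ?thesis
    unfolding decidable_def by (simp only:) (intro computable_diff computable_const assms)
qed

lemma decidable_eq:
  assumes "computable n A" and "computable n B"
  shows "decidable n (\<lambda>xs. A xs = B xs)"
  unfolding eq_iff by (intro decidable_conj decidable_le assms)

lemma decidable_set_decode:
  assumes "computable n A" and "computable n B"
  shows "decidable n (\<lambda>xs. A xs \<in> set_decode (B xs))"
proof -
  \<comment> \<open>Membership is a bit test; oddness of the shifted number is phrased through
    halving and comparison.\<close>
  have "a \<in> set_decode b \<longleftrightarrow> \<not> b div 2 ^ a \<le> 2 * (b div 2 ^ a div 2)" for a b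
  proof -
    have "odd c \<longleftrightarrow> \<not> c \<le> 2 * (c div 2)" for c :: nat
      by presburger
    then show ?thesis by (simp only: set_decode_def mem_Collect_eq)
  qed
  then show ?thesis
    by (simp only:) (intro decidable_not decidable_le computable_mult computable_const
      computable_div2 computable_div_power2 assms)
qed

lemma decidable_bex:
  assumes "computable n A" and "decidable (Suc n) (\<lambda>ys. P (hd ys) (tl ys))"
  shows "decidable n (\<lambda>xs. \<exists>m < A xs. P m xs)"
proof -
  \<comment> \<open>The recursion carries the truth value of the disjunction over the numbers met so
    far.\<close>
  have "(of_bool (\<exists>m < a. P m xs) :: nat) = rec_nat 0 (\<lambda>m v. of_bool (v = 1 \<or> P m xs)) a"
    for a and xs :: "nat list"
  proof (induction a)
    case (Suc a)
    show ?case unfolding nat.rec(2) Suc.IH[symmetric] by (auto simp: less_Suc_eq)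
  qed simp
  moreover have "decidable (Suc (Suc n)) (\<lambda>ys. P (hd ys) (tl (tl ys)))"
    using assms(2) unfolding decidable_def by (rule computable_skip)
  then have "computable (Suc (Suc n)) (\<lambda>ys. of_bool (hd (tl ys) = 1 \<or> P (hd ys) (tl (tl ys))))"
    unfolding decidable_def[symmetric]
    by (intro decidable_disj decidable_eq computable_const computable_var)
  ultimately show ?thesis
    unfolding decidable_def by (simp only:) (intro computable_rec_nat computable_const assms)
qed

lemma decidable_ball:
  assumes "computable n A" and "decidable (Suc n) (\<lambda>ys. P (hd ys) (tl ys))"
  shows "decidable n (\<lambda>xs. \<forall>m < A xs. P m xs)"
proof -
  have "decidable n (\<lambda>xs. \<not> (\<exists>m < A xs. \<not> P m xs))"
    by (intro decidable_not decidable_bex assms)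
  then show ?thesis by simp
qed

lemmas decidable_intros =
  decidable_ball decidable_bex decidable_iff decidable_imp decidable_conj decidable_disj
  decidable_not decidable_eq decidable_le decidable_set_decode

lemmas computable_intros =
  computable_var computable_const computable_Suc computable_add computable_power2
  computable_prod_encode

section \<open>Finite models\<close>

primrec modal_depth :: "fml \<Rightarrow> nat" where
  "modal_depth (Atom p) = 0"
| "modal_depth (NegAtom p) = 0"
| "modal_depth (Or \<phi> \<psi>) = max (modal_depth \<phi>) (modal_depth \<psi>)"
| "modal_depth (And \<phi> \<psi>) = max (modal_depth \<phi>) (modal_depth \<psi>)"
| "modal_depth (Dia \<phi>) = Suc (modal_depth \<phi>)"
| "modal_depth (Box \<phi>) = Suc (modal_depth \<phi>)"

primrec atoms :: "fml \<Rightarrow> nat set" where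
  "atoms (Atom p) = {p}"
| "atoms (NegAtom p) = {p}"
| "atoms (Or \<phi> \<psi>) = atoms \<phi> \<union> atoms \<psi>"
| "atoms (And \<phi> \<psi>) = atoms \<phi> \<union> atoms \<psi>"
| "atoms (Dia \<phi>) = atoms \<phi>"
| "atoms (Box \<phi>) = atoms \<phi>"

lemma less_prod_encode: "0 < a \<Longrightarrow> b < prod_encode (a, b)"
  by (induction b) (simp_all add: prod_encode_def)

text \<open>Strictness for \<open>Dia\<close> and \<open>Box\<close> comes from their positive tags
  and absorbs the successor in \<open>modal_depth\<close>.\<close>

lemma subformula_code_le:
  "fml_code \<phi> \<le> fml_code (Or \<phi> \<psi>)" "fml_code \<psi> \<le> fml_code (Or \<phi> \<psi>)"
  "fml_code \<phi> \<le> fml_code (And \<phi> \<psi>)" "fml_code \<psi> \<le> fml_code (And \<phi> \<psi>)"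
  "fml_code \<phi> < fml_code (Dia \<phi>)" "fml_code \<phi> < fml_code (Box \<phi>)"
  unfolding fml_code.simps
  by (auto intro: less_prod_encode le_trans[OF _ le_prod_encode_2] le_prod_encode_1 le_prod_encode_2)

text \<open>Together with \<open>atoms_le_code\<close>, this gives search bounds that are computed
  from the code without parsing it.\<close>

lemma modal_depth_le_code: "modal_depth \<phi> \<le> fml_code \<phi>"
proof (induction \<phi>)
  case (Or \<phi> \<psi>)
  then show ?case using subformula_code_le(1)[of \<phi> \<psi>] subformula_code_le(2)[of \<psi> \<phi>] by (simp del: fml_code.simps)
next
  case (And \<phi> \<psi>)
  then show ?case using subformula_code_le(3)[of \<phi> \<psi>] subformula_code_le(4)[of \<psi> \<phi>] by (simp del: fml_code.simps)
next
  case (Dia \<phi>)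
  then show ?case using subformula_code_le(5)[of \<phi>] by (simp del: fml_code.simps)
next
  case (Box \<phi>)
  then show ?case using subformula_code_le(6)[of \<phi>] by (simp del: fml_code.simps)
qed simp_all

lemma atoms_le_code: "p \<in> atoms \<phi> \<Longrightarrow> p \<le> fml_code \<phi>"
proof (induction \<phi>)
  case (Or \<phi> \<psi>)
  then show ?case
    using subformula_code_le(1)[of \<phi> \<psi>] subformula_code_le(2)[of \<psi> \<phi>] by (auto simp del: fml_code.simps)
next
  case (And \<phi> \<psi>)
  then show ?case
    using subformula_code_le(3)[of \<phi> \<psi>] subformula_code_le(4)[of \<psi> \<phi>] by (auto simp del: fml_code.simps)
next
  case (Dia \<phi>)
  then show ?case using subformula_code_le(5)[of \<phi>] by (simp del: fml_code.simps)
next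
  case (Box \<phi>)
  then show ?case using subformula_code_le(6)[of \<phi>] by (simp del: fml_code.simps)
qed (simp_all add: le_prod_encode_2)

section \<open>Numerical codes of bisimulation types of bounded depth\<close>

lemma prod_encode_mono: "a \<le> a' \<Longrightarrow> b \<le> b' \<Longrightarrow> prod_encode (a, b) \<le> prod_encode (a', b')"
  unfolding prod_encode_def triangle_def split
  by (intro add_mono div_le_mono mult_le_mono) simp_all

lemma set_encode_less:
  assumes "A \<subseteq> {..<b}"
  shows "set_encode A < 2 ^ b"
proof -
  have "set_encode A \<le> set_encode {..<b}"
    unfolding set_encode_def using assms by (intro sum_mono2) auto
  also have "\<dots> < 2 ^ b"
    by (induction b) (simp_all add: set_encode_def)
  finally show ?thesis .
qed

text \<open>Equality of these numbers at the same \<open>m\<close> is bisimilarity up to depth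
  \<open>m\<close> over the atoms below \<open>a\<close>. Numbers in place of equivalence classes
  make the quotient a set of naturals with a computable bound.\<close>

primrec bisim_type :: "('w \<times> 'w) set \<Rightarrow> (nat \<Rightarrow> 'w set) \<Rightarrow> nat \<Rightarrow> nat \<Rightarrow> 'w \<Rightarrow> nat" where
  "bisim_type R V a 0 x = set_encode {p. p < a \<and> x \<in> V p}"
| "bisim_type R V a (Suc m) x = prod_encode (set_encode {p. p < a \<and> x \<in> V p},
     set_encode (bisim_type R V a m ` (R `` {x})))"

text \<open>A tower of exponentials: a type of depth \<open>Suc m\<close> contains a set of types of
  depth \<open>m\<close>, whose code lies below \<open>2 ^ type_bound a m\<close>.\<close>

primrec type_bound :: "nat \<Rightarrow> nat \<Rightarrow> nat" where
  "type_bound a 0 = 2 ^ a"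
| "type_bound a (Suc m) = Suc (prod_encode (2 ^ a, 2 ^ type_bound a m))"

definition world_bound :: "nat \<Rightarrow> nat \<Rightarrow> nat" where
  "world_bound a d = Suc (prod_encode (d, type_bound a d))"

lemma bisim_type_less: "bisim_type R V a m x < type_bound a m"
proof (induction m arbitrary: x)
  case 0
  show ?case by (auto intro: set_encode_less)
next
  case (Suc m)
  have "set_encode {p. p < a \<and> x \<in> V p} \<le> 2 ^ a"
    by (rule less_imp_le, rule set_encode_less) auto
  moreover have "set_encode (bisim_type R V a m ` (R `` {x})) \<le> 2 ^ type_bound a m"
    by (rule less_imp_le, rule set_encode_less) (use Suc in auto)
  ultimately show ?case by (simp add: prod_encode_mono less_Suc_eq_le)
qed

lemma type_bound_mono:
  assumes "m \<le> d"
  shows "type_bound a m \<le> type_bound a d"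
  using assms
proof (rule lift_Suc_mono_le[of "type_bound a", rotated])
  fix m
  have "type_bound a m < 2 ^ type_bound a m" by simp
  also have "\<dots> \<le> prod_encode (2 ^ a, 2 ^ type_bound a m)" by (rule le_prod_encode_2)
  finally show "type_bound a m \<le> type_bound a (Suc m)" by simp
qed

text \<open>\<open>set_encode\<close> is faithful on finite sets only. A world may have infinitely
  many successors, but their types are bounded numbers.\<close>

lemma finite_bisim_type_image: "finite (bisim_type R V a m ` A)"
  by (rule finite_subset[of _ "{..<type_bound a m}"]) (auto simp: bisim_type_less)

lemma bisim_type_atom:
  assumes "bisim_type R V a m x = bisim_type R V a m y" and "p < a"
  shows "x \<in> V p \<longleftrightarrow> y \<in> V p"
proof -
  have fin: "finite {p. p < a \<and> z \<in> V p}" for z by simp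
  have "set_encode {p. p < a \<and> x \<in> V p} = set_encode {p. p < a \<and> y \<in> V p}"
    using assms(1) by (cases m) simp_all
  then have "{p. p < a \<and> x \<in> V p} = {p. p < a \<and> y \<in> V p}"
    using set_encode_eq[OF fin fin] by blast
  then show ?thesis using assms(2) by blast
qed

text \<open>Both encodings are injective here, so worlds of equal type have the same set of
  successor types.\<close>

lemma bisim_type_zig:
  assumes "bisim_type R V a (Suc m) x = bisim_type R V a (Suc m) y" and "(x, x') \<in> R"
  obtains y' where "(y, y') \<in> R" and "bisim_type R V a m y' = bisim_type R V a m x'"
proof -
  have "bisim_type R V a m ` (R `` {x}) = bisim_type R V a m ` (R `` {y})"
    using assms(1) by (simp add: set_encode_eq finite_bisim_type_image)
  then have "bisim_type R V a m x' \<in> bisim_type R V a m ` (R `` {y})"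
    using assms(2) by blast
  then show thesis using that by auto
qed

text \<open>The assumption matches successors one depth higher than required; the induction
  hypothesis lowers that depth, so the sets of successor types agree.\<close>

lemma bisim_type_Suc_D:
  "bisim_type R V a (Suc m) x = bisim_type R V a (Suc m) y \<Longrightarrow>
    bisim_type R V a m x = bisim_type R V a m y"
proof (induction m arbitrary: x y)
  case (Suc m)
  have "bisim_type R V a m ` (R `` {u}) \<subseteq> bisim_type R V a m ` (R `` {v})"
    if "bisim_type R V a (Suc (Suc m)) u = bisim_type R V a (Suc (Suc m)) v" for u v
  proof clarify
    fix u' assume "(u, u') \<in> R"
    with that obtain v' where "(v, v') \<in> R" "bisim_type R V a (Suc m) v' = bisim_type R V a (Suc m) u'"
      by (rule bisim_type_zig)
    then show "bisim_type R V a m u' \<in> bisim_type R V a m ` (R `` {v})"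
      using Suc.IH by (metis Image_singleton_iff imageI)
  qed
  from this[OF Suc.prems] this[OF Suc.prems[symmetric]]
  have "bisim_type R V a m ` (R `` {x}) = bisim_type R V a m ` (R `` {y})" by (rule equalityI)
  moreover have "set_encode {p. p < a \<and> x \<in> V p} = set_encode {p. p < a \<and> y \<in> V p}"
    using Suc.prems by simp
  ultimately show ?case by simp
qed simp

lemma bisim_type_antimono:
  assumes "m' \<le> m" and "bisim_type R V a m x = bisim_type R V a m y"
  shows "bisim_type R V a m' x = bisim_type R V a m' y"
  using assms by (induction m rule: dec_induct) (auto dest: bisim_type_Suc_D simp del: bisim_type.simps)

section \<open>The layered frame\<close>

context
  fixes R :: "('w \<times> 'w) set" and V :: "nat \<Rightarrow> 'w set" and W :: "'w set" and a d :: nat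
  assumes R: "R \<subseteq> W \<times> W"
begin

abbreviation "tp \<equiv> bisim_type R V a"

definition layered :: "((nat \<times> 'w) \<times> (nat \<times> 'w)) set" where
  "layered = {((m, x), (m', y)). m \<le> d \<and> x \<in> W \<and> m' \<le> d \<and> y \<in> W \<and>
     (0 < m \<longrightarrow> m - 1 \<le> m' \<and> (\<exists>y'. (x, y') \<in> R \<and> tp (m - 1) y' = tp (m - 1) y))}"

text \<open>The level is kept in the code because it governs the outgoing edges, and types of
  different depths may coincide as numbers.\<close>

definition world_code :: "nat \<times> 'w \<Rightarrow> nat" where
  "world_code = (\<lambda>(m, x). prod_encode (m, tp m x))"

text \<open>The source can be exchanged by \<open>bisim_type_zig\<close>. The target can be
  exchanged because its level is at least \<open>m - 1\<close>, so agreement up to depth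
  \<open>n\<close> includes the depth that the edge inspects.\<close>

lemma layered_code_cong:
  assumes edge: "((m, x), (n, y)) \<in> layered"
    and "x' \<in> W" "y' \<in> W" "tp m x = tp m x'" "tp n y = tp n y'"
  shows "((m, x'), (n, y')) \<in> layered"
proof (cases m)
  case 0
  then show ?thesis using assms by (simp add: layered_def)
next
  case (Suc l)
  then obtain z where z: "l \<le> n" "(x, z) \<in> R" "tp l z = tp l y"
    using edge by (auto simp: layered_def)
  obtain z' where "(x', z') \<in> R" "tp l z' = tp l z"
    using assms(4) z(2) unfolding Suc by (rule bisim_type_zig)
  moreover have "tp l y = tp l y'" using z(1) assms(5) by (rule bisim_type_antimono)
  ultimately show ?thesis using assms z Suc by (auto simp: layered_def)
qed

text \<open>Induction along the path: before each edge the level is still positive, so the edge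
  follows \<open>R\<close> up to bisimilarity, and \<open>bisim_type_zig\<close> transfers it to the
  projected path.\<close>

lemma layered_project:
  assumes "((m, x), (n, y)) \<in> layered ^^ k" and "k \<le> m" and "x \<in> W"
  shows "m - k \<le> n \<and> (\<exists>y'. (x, y') \<in> R ^^ k \<and> tp (m - k) y' = tp (m - k) y)"
  using assms
proof (induction k arbitrary: n y)
  case (Suc k)
  then obtain l z where z: "((m, x), (l, z)) \<in> layered ^^ k" "((l, z), (n, y)) \<in> layered"
    by auto
  obtain j where j: "m - k = Suc j" "j = m - Suc k" using Suc.prems(2) by (cases "m - k") auto
  from Suc z(1) obtain z' where z': "m - k \<le> l" "(x, z') \<in> R ^^ k" "tp (m - k) z' = tp (m - k) z"
    by auto
  from z(2) z'(1) j obtain y' where y': "l - 1 \<le> n" "(z, y') \<in> R" "tp (l - 1) y' = tp (l - 1) y"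
    by (auto simp: layered_def)
  \<comment> \<open>The edge is faithful up to depth \<open>l - 1\<close>, and only depth
    \<open>j\<close> is still tracked.\<close>
  have "j \<le> l - 1" using z'(1) j(1) by simp
  then have "tp j y' = tp j y" using y'(3) by (rule bisim_type_antimono)
  moreover from z'(3)[symmetric] y'(2) obtain y'' where "(z', y'') \<in> R" "tp j y'' = tp j y'"
    unfolding j(1) by (rule bisim_type_zig)
  ultimately show ?case using z'(2) \<open>j \<le> l - 1\<close> y'(1) j(2) by auto
qed simp

text \<open>The lifted path keeps the given worlds and descends one level per edge. Once
  \<open>k\<close> exceeds \<open>m\<close>, truncated subtraction keeps it at level 0, where edges
  are unrestricted.\<close>

lemma layered_lift:
  assumes "(x, y) \<in> R ^^ k" and "x \<in> W" and "m \<le> d"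
  shows "y \<in> W \<and> ((m, x), (m - k, y)) \<in> layered ^^ k"
  using assms(1)
proof (induction k arbitrary: y)
  case (Suc k)
  then obtain z where z: "(x, z) \<in> R ^^ k" "(z, y) \<in> R" by auto
  then have "((m - k, z), (m - Suc k, y)) \<in> layered"
    using Suc.IH[of z] R assms(3) by (auto simp: layered_def)
  then show ?case using Suc.IH[of z] z R by auto
qed (use assms in simp)

lemma layered_bottom:
  assumes "x \<in> W" and "y \<in> W" and "m \<le> d"
  shows "((0, x), (m, y)) \<in> layered ^^ Suc k"
proof (induction k)
  case 0
  show ?case using assms by (simp add: layered_def)
next
  case (Suc k)
  have "((0, x), (0, x)) \<in> layered" using assms by (simp add: layered_def)
  then show ?case using Suc.IH by (rule relpow_Suc_I2)
qed

lemma layered_qdp: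
  assumes qdp: "satisfies_qdp W R q" and "fst q < snd q"
  shows "satisfies_qdp ({..d} \<times> W) layered q"
  unfolding satisfies_qdp_def
proof clarify
  fix m x n y
  assume m: "m \<le> d" "x \<in> W" and n: "n \<le> d" "y \<in> W"
    and path: "((m, x), (n, y)) \<in> layered ^^ fst q"
  define k where "k = fst q"
  obtain l where l: "snd q = Suc l" "k \<le> l" using assms(2) by (cases "snd q") (auto simp: k_def)
  have "((m, x), (n, y)) \<in> layered ^^ Suc l"
  proof (cases "k \<le> m")
    case True
    \<comment> \<open>The projection ends in some \<open>y'\<close> that agrees with
      \<open>y\<close> only up to depth \<open>m - k\<close>; quasi-density is applied to
      \<open>y'\<close>.\<close>
    with path m obtain y' where y': "m - k \<le> n" "(x, y') \<in> R ^^ k" "tp (m - k) y' = tp (m - k) y"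
      using layered_project unfolding k_def by blast
    have "y' \<in> W" using layered_lift[OF y'(2) m(2,1)] by blast
    then have "(x, y') \<in> R ^^ Suc l"
      using qdp m(2) y'(2) l(1) unfolding satisfies_qdp_def k_def by metis
    \<comment> \<open>All edges but the last are lifted as they are; the last one is redirected from
      \<open>y'\<close> to \<open>(n, y)\<close>.\<close>
    then obtain z where z: "(x, z) \<in> R ^^ l" "(z, y') \<in> R" by auto
    have zW: "z \<in> W" and path': "((m, x), (m - l, z)) \<in> layered ^^ l"
      using layered_lift[OF z(1) m(2,1)] by auto
    \<comment> \<open>Redirecting asks for agreement up to depth \<open>m - l - 1\<close> only,
      which is at most \<open>m - k\<close> since \<open>k \<le> l\<close>.\<close>
    have "tp (m - l - 1) y' = tp (m - l - 1) y"
      using _ y'(3) by (rule bisim_type_antimono) (use l(2) in simp)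
    then have "((m - l, z), (n, y)) \<in> layered"
      using zW z(2) m n y'(1) l(2) by (auto simp: layered_def)
    then show ?thesis using path' by auto
  next
    case False
    then have "((m, x), (n, y)) \<in> layered ^^ (m + (k - m))" using path by (simp add: k_def)
    \<comment> \<open>The point reached after \<open>m\<close> edges need not lie at level 0, since
      edges may climb. The prefix is therefore projected to \<open>R\<close> and lifted again, which
      ends at level 0.\<close>
    then obtain j z where "((m, x), (j, z)) \<in> layered ^^ m" by (auto simp: relpow_add)
    with m obtain z' where "(x, z') \<in> R ^^ m" using layered_project by blast
    from layered_lift[OF this m(2,1)]
    have z': "z' \<in> W" "((m, x), (0, z')) \<in> layered ^^ m" by simp_all
    have "((0, z'), (n, y)) \<in> layered ^^ Suc (l - m)" using z'(1) n(2,1) by (rule layered_bottom)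
    then have "((m, x), (n, y)) \<in> layered ^^ (m + Suc (l - m))"
      using z'(2) unfolding relpow_add by blast
    then show ?thesis using False l(2) by (simp del: relpow.simps)
  qed
  then show "((m, x), (n, y)) \<in> layered ^^ snd q" by (simp only: l)
qed

section \<open>The quotient by level and type\<close>

abbreviation "quot_worlds \<equiv> world_code ` ({..d} \<times> W)"
abbreviation "quot_rel \<equiv> map_prod world_code world_code ` layered"
abbreviation "quot_val \<equiv> \<lambda>p. world_code ` ({..d} \<times> (V p \<inter> W))"

text \<open>By \<open>layered_code_cong\<close>, an edge between classes starts at every
  representative of its source. Hence paths of the quotient lift to the layered frame from any
  chosen start.\<close>

lemma quot_rel_iff:
  assumes "m \<le> d" and "x \<in> W"
  shows "(world_code (m, x), v) \<in> quot_rel \<longleftrightarrow>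
    (\<exists>n y. v = world_code (n, y) \<and> ((m, x), (n, y)) \<in> layered)"
proof
  assume "(world_code (m, x), v) \<in> quot_rel"
  then obtain m' x' n y where e: "((m', x'), (n, y)) \<in> layered"
      "world_code (m, x) = world_code (m', x')" "v = world_code (n, y)"
    by auto
  then have "m = m'" "tp m x = tp m x'" by (auto simp: world_code_def)
  then have "((m, x), (n, y)) \<in> layered"
    using layered_code_cong[OF e(1), of x y] assms e(1) by (auto simp: layered_def)
  then show "\<exists>n y. v = world_code (n, y) \<and> ((m, x), (n, y)) \<in> layered" using e(3) by blast
qed force

lemma quot_relpow_D:
  assumes "(world_code u, v) \<in> quot_rel ^^ k" and "u \<in> {..d} \<times> W"
  shows "\<exists>v'\<in>{..d} \<times> W. v = world_code v' \<and> (u, v') \<in> layered ^^ k"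
  using assms(1)
proof (induction k arbitrary: v)
  case 0
  then show ?case using assms(2) by auto
next
  case (Suc k)
  then obtain z where z: "(world_code u, z) \<in> quot_rel ^^ k" "(z, v) \<in> quot_rel" by auto
  from Suc.IH[OF z(1)] obtain m y where y: "m \<le> d" "y \<in> W" "z = world_code (m, y)"
    "(u, (m, y)) \<in> layered ^^ k" by auto
  with z(2) obtain n x where "v = world_code (n, x)" "((m, y), (n, x)) \<in> layered"
    using quot_rel_iff[OF y(1,2)] by auto
  then show ?case using y(4) by (auto simp: layered_def intro!: bexI[of _ "(n, x)"])
qed

lemma quot_is_model:
  assumes "W \<noteq> {}" and "\<forall>q\<in>P. fst q < snd q \<and> satisfies_qdp W R q"
  shows "is_model P quot_worlds quot_rel quot_val"
  unfolding is_model_def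
proof (intro conjI ballI allI)
  fix q assume "q \<in> P"
  then have qdp: "satisfies_qdp ({..d} \<times> W) layered q"
    using assms(2) by (intro layered_qdp) simp_all
  show "satisfies_qdp quot_worlds quot_rel q"
    unfolding satisfies_qdp_def
  proof (intro ballI impI)
    fix u v assume u: "u \<in> quot_worlds" and "v \<in> quot_worlds" and path: "(u, v) \<in> quot_rel ^^ fst q"
    then obtain u' where u': "u' \<in> {..d} \<times> W" "u = world_code u'" by blast
    \<comment> \<open>The representative of \<open>v\<close> is taken to be the end of the lifted
      path, so that \<open>qdp\<close> applies to the two ends of a single path in
      \<open>layered\<close>.\<close>
    from quot_relpow_D[OF path[unfolded u'(2)] u'(1)]
    obtain v' where v': "v' \<in> {..d} \<times> W" "v = world_code v'" "(u', v') \<in> layered ^^ fst q"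
      by (elim bexE conjE)
    have "(u', v') \<in> layered ^^ snd q"
      using qdp[unfolded satisfies_qdp_def, rule_format, OF u'(1) v'(1,3)] .
    then show "(u, v) \<in> quot_rel ^^ snd q" unfolding u'(2) v'(2) by (rule relpow_image)
  qed
next
  show "quot_rel \<subseteq> quot_worlds \<times> quot_worlds"
  proof (rule image_subsetI)
    fix e assume "e \<in> layered"
    then have "fst e \<in> {..d} \<times> W" "snd e \<in> {..d} \<times> W" by (auto simp: layered_def)
    then show "map_prod world_code world_code e \<in> quot_worlds \<times> quot_worlds"
      by (cases e) simp
  qed
  show "quot_worlds \<noteq> {}" using assms(1) by simp
  show "quot_val p \<subseteq> quot_worlds" for p by (intro image_mono) blast
qed

lemma quot_atom:
  assumes "m \<le> d" and "x \<in> W" and "p < a"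
  shows "world_code (m, x) \<in> quot_val p \<longleftrightarrow> x \<in> V p"
proof
  assume "world_code (m, x) \<in> quot_val p"
  then obtain y where "y \<in> V p" "tp m x = tp m y" by (auto simp: world_code_def)
  then show "x \<in> V p" using bisim_type_atom[of R V a m x y p] assms(3) by simp
qed (use assms in simp)

text \<open>Invariance of truth under bisimilarity comes from the induction hypothesis itself: if
  \<open>y\<close> and \<open>y'\<close> agree up to depth \<open>l\<close>, then
  \<open>(l, y)\<close> and \<open>(l, y')\<close> have the same code, and using the hypothesis at
  both transfers truth between \<open>y\<close> and \<open>y'\<close>.\<close>

lemma quot_sat:
  assumes "m \<le> d" and "x \<in> W" and "modal_depth \<phi> \<le> m" and "atoms \<phi> \<subseteq> {..<a}"
  shows "sat quot_rel quot_val (world_code (m, x)) \<phi> \<longleftrightarrow> sat R V x \<phi>"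
  using assms
proof (induction \<phi> arbitrary: m x)
  case (Atom p)
  then show ?case using quot_atom[of m x p] by simp
next
  case (NegAtom p)
  then show ?case using quot_atom[of m x p] by simp
next
  case (Dia \<phi>)
  then obtain l where l: "m = Suc l" "modal_depth \<phi> \<le> l" by (cases m) auto
  show ?case
  proof
    assume "sat quot_rel quot_val (world_code (m, x)) (Dia \<phi>)"
    then obtain n y where y: "((m, x), (n, y)) \<in> layered"
        "sat quot_rel quot_val (world_code (n, y)) \<phi>"
      using quot_rel_iff[OF Dia.prems(1,2)] by auto
    then obtain y' where y': "l \<le> n" "n \<le> d" "y \<in> W" "(x, y') \<in> R" "tp l y' = tp l y"
      using l by (auto simp: layered_def)
    have "y' \<in> W" "l \<le> d" using y' R by auto
    \<comment> \<open>The target level \<open>n\<close> may exceed \<open>l\<close>. Truth passes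
      from level \<open>n\<close> to \<open>y\<close> in the given model and from there to level
      \<open>l\<close>, where \<open>y\<close> and \<open>y'\<close> share a code.\<close>
    have "sat R V y \<phi>" using y(2) Dia.IH[of n y] Dia.prems y' l by simp
    then have "sat quot_rel quot_val (world_code (l, y)) \<phi>"
      using Dia.IH[of l y] Dia.prems \<open>l \<le> d\<close> y' l by simp
    moreover have "world_code (l, y) = world_code (l, y')" using y'(5) by (simp add: world_code_def)
    ultimately have "sat R V y' \<phi>"
      using Dia.IH[of l y'] Dia.prems \<open>l \<le> d\<close> \<open>y' \<in> W\<close> l by simp
    then show "sat R V x (Dia \<phi>)" using y'(4) by auto
  next
    assume "sat R V x (Dia \<phi>)"
    then obtain y where y: "(x, y) \<in> R" "sat R V y \<phi>" by auto
    then have "y \<in> W" using R by blast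
    then have "((m, x), (l, y)) \<in> layered" using Dia.prems l y by (auto simp: layered_def)
    moreover have "sat quot_rel quot_val (world_code (l, y)) \<phi>"
      using Dia.IH[of l y] Dia.prems \<open>y \<in> W\<close> y(2) l by simp
    ultimately show "sat quot_rel quot_val (world_code (m, x)) (Dia \<phi>)"
      using quot_rel_iff[OF Dia.prems(1,2)] by auto
  qed
next
  case (Box \<phi>)
  then obtain l where l: "m = Suc l" "modal_depth \<phi> \<le> l" by (cases m) auto
  show ?case
  proof
    assume box: "sat quot_rel quot_val (world_code (m, x)) (Box \<phi>)"
    show "sat R V x (Box \<phi>)"
      unfolding sat.simps
    proof (intro allI impI)
      fix y assume y: "(x, y) \<in> R"
      then have "y \<in> W" using R by blast
      then have "((m, x), (l, y)) \<in> layered" using Box.prems l y by (auto simp: layered_def)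
      then have "sat quot_rel quot_val (world_code (l, y)) \<phi>"
        using box quot_rel_iff[OF Box.prems(1,2)] by auto
      then show "sat R V y \<phi>" using Box.IH[of l y] Box.prems \<open>y \<in> W\<close> l by simp
    qed
  next
    assume box: "sat R V x (Box \<phi>)"
    show "sat quot_rel quot_val (world_code (m, x)) (Box \<phi>)"
      unfolding sat.simps
    proof (intro allI impI)
      fix v assume "(world_code (m, x), v) \<in> quot_rel"
      then obtain n y where y: "v = world_code (n, y)" "((m, x), (n, y)) \<in> layered"
        using quot_rel_iff[OF Box.prems(1,2)] by auto
      then obtain y' where y': "l \<le> n" "n \<le> d" "y \<in> W" "(x, y') \<in> R" "tp l y' = tp l y"
        using l by (auto simp: layered_def)
      have "y' \<in> W" "l \<le> d" using y' R by auto
      have "sat R V y' \<phi>" using box y'(4) by simp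
      then have "sat quot_rel quot_val (world_code (l, y')) \<phi>"
        using Box.IH[of l y'] Box.prems \<open>l \<le> d\<close> \<open>y' \<in> W\<close> l by simp
      moreover have "world_code (l, y) = world_code (l, y')" using y'(5) by (simp add: world_code_def)
      ultimately have "sat R V y \<phi>"
        using Box.IH[of l y] Box.prems \<open>l \<le> d\<close> y' l by simp
      then show "sat quot_rel quot_val v \<phi>"
        using Box.IH[of n y] Box.prems y(1) y' l by simp
    qed
  qed
next
  case (Or \<phi> \<psi>)
  then show ?case using Or.IH[of m x] by simp
next
  case (And \<phi> \<psi>)
  then show ?case using And.IH[of m x] by simp
qed

lemma quot_worlds_bounded: "quot_worlds \<subseteq> {..<world_bound a d}"
proof clarify
  fix m x assume "m \<le> d"
  moreover have "tp m x \<le> type_bound a d"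
    using less_imp_le[OF bisim_type_less] type_bound_mono[OF \<open>m \<le> d\<close>] by (rule le_trans)
  ultimately show "world_code (m, x) < world_bound a d"
    unfolding world_code_def world_bound_def split less_Suc_eq_le by (rule prod_encode_mono)
qed

end

theorem finite_countermodel:
  assumes m: "is_model P W R V" and "w \<in> W" and "\<not> sat R V w \<phi>" and "\<forall>q\<in>P. is_qdp q"
    and "modal_depth \<phi> \<le> d" and "atoms \<phi> \<subseteq> {..<a}"
  obtains W' R' V' w' where "is_model P W' R' V'" "W' \<subseteq> {..<world_bound a d}" "w' \<in> W'"
    "\<not> sat R' V' w' \<phi>"
proof -
  have R: "R \<subseteq> W \<times> W" using m by (simp add: is_model_def)
  have "W \<noteq> {}" "\<forall>q\<in>P. fst q < snd q \<and> satisfies_qdp W R q"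
    using m assms(4) by (simp_all add: is_model_def is_qdp_def)
  note model = quot_is_model[OF R this, of V a d]
  show thesis
  proof (rule that[OF model quot_worlds_bounded[OF R]])
    \<comment> \<open>The refuting world is placed at the top level, which covers the full depth of
      the formula.\<close>
    show "world_code R V a (d, w) \<in> world_code R V a ` ({..d} \<times> W)" using assms(2) by auto
    show "\<not> sat (map_prod (world_code R V a) (world_code R V a) ` layered R V W a d)
        (\<lambda>p. world_code R V a ` ({..d} \<times> (V p \<inter> W))) (world_code R V a (d, w)) \<phi>"
      unfolding quot_sat[OF R order_refl assms(2,5,6)] by (rule assms(3))
  qed
qed

section \<open>Countermodels coded as single numbers\<close>

section \<open>Refutation tables\<close>

text \<open>The tags 0 here and 1 in \<open>false_entry\<close> keep the two kinds of entries apart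
  within one number, so that a single bounded search covers both.\<close>

definition path_entry :: "nat \<Rightarrow> nat \<Rightarrow> nat \<Rightarrow> nat \<Rightarrow> bool" where
  "path_entry s l x y \<longleftrightarrow> prod_encode (0, prod_encode (l, prod_encode (x, y))) \<in> set_decode s"

definition false_entry :: "nat \<Rightarrow> nat \<Rightarrow> nat \<Rightarrow> bool" where
  "false_entry s k w \<longleftrightarrow> prod_encode (1, prod_encode (k, w)) \<in> set_decode s"

text \<open>The table \<open>s\<close> lists the worlds (the diagonal of the paths of length 0), the paths up to the
  lengths occurring in the properties coded by \<open>c\<close>, and formula codes with worlds at which the
  formula fails.  As in a Hintikka set, the latter need only be closed in one direction, so that
  numbers that code no formula cause no trouble.\<close>

definition refutation_table :: "nat \<Rightarrow> nat \<Rightarrow> nat \<Rightarrow> nat \<Rightarrow> bool" where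
  "refutation_table c e N s \<longleftrightarrow>
     (\<forall>x<N. \<forall>y<N. path_entry s 0 x y \<longrightarrow> x = y) \<and>
     (\<forall>x<N. \<forall>y<N. path_entry s 1 x y \<longrightarrow> path_entry s 0 x x \<and> path_entry s 0 y y) \<and>
     (\<forall>l<c. \<forall>x<N. \<forall>y<N. path_entry s (Suc l) x y \<longleftrightarrow>
        (\<exists>z<N. path_entry s l x z \<and> path_entry s 1 z y)) \<and>
     (\<forall>k<c. \<forall>n<c. prod_encode (k, n) \<in> set_decode c \<longrightarrow>
        (\<forall>x<N. \<forall>y<N. path_entry s k x y \<longrightarrow> path_entry s n x y)) \<and>
     (\<forall>a<Suc e. \<forall>b<Suc e. \<forall>w<N.
        (false_entry s (prod_encode (1, a)) w \<longrightarrow> \<not> false_entry s (prod_encode (0, a)) w) \<and>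
        (false_entry s (prod_encode (2, prod_encode (a, b))) w \<longrightarrow>
           false_entry s a w \<and> false_entry s b w) \<and>
        (false_entry s (prod_encode (3, prod_encode (a, b))) w \<longrightarrow>
           false_entry s a w \<or> false_entry s b w) \<and>
        (false_entry s (prod_encode (4, a)) w \<longrightarrow>
           (\<forall>v<N. path_entry s 1 w v \<longrightarrow> false_entry s a v)) \<and>
        (false_entry s (prod_encode (5, a)) w \<longrightarrow>
           (\<exists>v<N. path_entry s 1 w v \<and> false_entry s a v))) \<and>
     (\<exists>w<N. path_entry s 0 w w \<and> false_entry s e w)"

text \<open>By monotonicity of pairing, the exponent exceeds the code of every entry:
  \<open>Suc (c + e)\<close> dominates path lengths up to \<open>Suc c\<close> and formula codes up
  to \<open>e\<close>, and \<open>prod_encode (N, N)\<close> dominates a pair of worlds as well as a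
  single world.\<close>

definition table_bound :: "nat \<Rightarrow> nat \<Rightarrow> nat \<Rightarrow> nat" where
  "table_bound c e N = 2 ^ Suc (prod_encode (1, prod_encode (Suc (c + e), prod_encode (N, N))))"

text \<open>For the formula coded by \<open>e\<close>, the depth is at most \<open>e\<close> and all
  atoms lie below \<open>Suc e\<close>; \<open>world_bound\<close> at these values is the size
  provided by \<open>finite_countermodel\<close>.\<close>

definition refutable :: "nat \<Rightarrow> nat \<Rightarrow> bool" where
  "refutable c e \<longleftrightarrow>
     (\<exists>s < table_bound c e (world_bound (Suc e) e). refutation_table c e (world_bound (Suc e) e) s)"

lemma set_decode_less:
  assumes "x \<in> set_decode n"
  shows "x < n"
proof -
  have "2 ^ x \<le> n"
    using assms by (cases "n < 2 ^ x") (auto simp: set_decode_def)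
  then show ?thesis using less_exp[of x] by linarith
qed

lemma refutation_table_imp_not_in_logic:
  assumes table: "refutation_table (qdps_code P) (fml_code \<phi>) N s" and fin: "finite P"
  shows "\<phi> \<notin> logic P"
proof
  assume "\<phi> \<in> logic P"
  define c where "c = qdps_code P"
  define e where "e = fml_code \<phi>"
  define W where "W = {x. x < N \<and> path_entry s 0 x x}"
  define R where "R = {(x, y). x < N \<and> y < N \<and> path_entry s 1 x y}"
  \<comment> \<open>Atoms hold unless marked false. A marked \<open>NegAtom p\<close> then fails,
    because the table forbids marking \<open>Atom p\<close> at the same world.\<close>
  define V where "V p = {w \<in> W. \<not> false_entry s (prod_encode (0, p)) w}" for p
  note table' = table[unfolded refutation_table_def, folded c_def e_def]
  note diag = table'[THEN conjunct1, rule_format]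
  note table' = table'[THEN conjunct2]
  note field = table'[THEN conjunct1, rule_format]
  note table' = table'[THEN conjunct2]
  note step = table'[THEN conjunct1, rule_format]
  note table' = table'[THEN conjunct2]
  note qdp = table'[THEN conjunct1, rule_format]
  note table' = table'[THEN conjunct2]
  note clauses = table'[THEN conjunct1, rule_format, unfolded less_Suc_eq_le]
  note root = table'[THEN conjunct2]
  have R: "R \<subseteq> W \<times> W" unfolding R_def W_def using field by blast
  have path: "(x, y) \<in> R ^^ l \<longleftrightarrow> path_entry s l x y" if "x \<in> W" "y \<in> W" "l \<le> c" for x y l
    using that(2,3)
  proof (induction l arbitrary: y)
    case 0
    have "x < N" "y < N" "path_entry s 0 x x" using 0 that(1) by (simp_all add: W_def)
    then show ?case using diag[of x y] by (cases "x = y") auto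
  next
    case (Suc l)
    have "(x, y) \<in> R ^^ Suc l \<longleftrightarrow> (\<exists>z\<in>W. (x, z) \<in> R ^^ l \<and> (z, y) \<in> R)" using R by (simp only: relpow.simps relcomp_unfold) blast
    also have "\<dots> \<longleftrightarrow> (\<exists>z\<in>W. path_entry s l x z \<and> (z, y) \<in> R)"
      using Suc.IH Suc.prems(2) by (intro bex_cong conj_cong refl) simp
    also have "\<dots> \<longleftrightarrow> (\<exists>z<N. path_entry s l x z \<and> path_entry s 1 z y)"
      using field[of _ y] Suc.prems(1) unfolding R_def W_def by blast
    also have "\<dots> \<longleftrightarrow> path_entry s (Suc l) x y"
      using step[of l x y] Suc.prems that(1) by (simp add: W_def)
    finally show ?case .
  qed
  obtain w where w: "w \<in> W" "false_entry s e w" using root unfolding W_def by blast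
  have model: "is_model P W R V"
    unfolding is_model_def
  proof (intro conjI ballI allI)
    show "W \<noteq> {}" using w(1) by blast
    show "V p \<subseteq> W" for p by (auto simp: V_def)
    fix q assume "q \<in> P"
    obtain k n where q: "q = (k, n)" by (cases q)
    have mem: "prod_encode (k, n) \<in> set_decode c"
      using \<open>q \<in> P\<close> fin by (simp add: c_def qdps_code_def q)
    \<comment> \<open>Members of a coded set are smaller than its code, so every property in
      \<open>P\<close> falls under the quantifiers bounded by \<open>c\<close>.\<close>
    have kn: "k < c" "n < c"
      using set_decode_less[OF mem] le_prod_encode_1[of k n] le_prod_encode_2[of n k] by simp_all
    show "satisfies_qdp W R q"
      unfolding satisfies_qdp_def q fst_conv snd_conv
    proof (intro ballI impI)
      fix x y assume xy: "x \<in> W" "y \<in> W" "(x, y) \<in> R ^^ k"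
      then have "path_entry s k x y" using path kn by simp
      then have "path_entry s n x y" using qdp[OF kn mem] xy by (simp add: W_def)
      then show "(x, y) \<in> R ^^ n" using path kn xy by simp
    qed
  qed (rule R)
  \<comment> \<open>Half of a truth lemma: marked formulae fail, and nothing is claimed about
    unmarked ones.\<close>
  have "\<not> sat R V w \<psi>" if "false_entry s (fml_code \<psi>) w" "fml_code \<psi> \<le> e" "w \<in> W" for \<psi> w
    using that
  proof (induction \<psi> arbitrary: w)
    case (Atom p)
    then show ?case by (simp add: V_def)
  next
    case (NegAtom p)
    then have "p \<le> e" "w < N" using le_prod_encode_2[of p 1] by (simp_all add: W_def)
    then have "\<not> false_entry s (prod_encode (0, p)) w"
      using clauses[of p p w] NegAtom.prems(1) by simp
    then show ?case using NegAtom.prems(3) by (simp add: V_def)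
  next
    case (Or \<psi>1 \<psi>2)
    then have le: "fml_code \<psi>1 \<le> e" "fml_code \<psi>2 \<le> e"
      using subformula_code_le(1)[of \<psi>1 \<psi>2] subformula_code_le(2)[of \<psi>2 \<psi>1] by linarith+
    then have "false_entry s (fml_code \<psi>1) w \<and> false_entry s (fml_code \<psi>2) w"
      using clauses[OF le, of w] Or.prems(1,3) by (simp add: W_def)
    then show ?case using Or.IH le Or.prems(3) by simp
  next
    case (And \<psi>1 \<psi>2)
    then have le: "fml_code \<psi>1 \<le> e" "fml_code \<psi>2 \<le> e"
      using subformula_code_le(3)[of \<psi>1 \<psi>2] subformula_code_le(4)[of \<psi>2 \<psi>1] by linarith+
    then have "false_entry s (fml_code \<psi>1) w \<or> false_entry s (fml_code \<psi>2) w"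
      using clauses[OF le, of w] And.prems(1,3) by (simp add: W_def)
    then show ?case using And.IH le And.prems(3) by auto
  next
    case (Dia \<psi>)
    then have le: "fml_code \<psi> \<le> e" using subformula_code_le(5)[of \<psi>] by linarith
    then have "\<forall>v<N. path_entry s 1 w v \<longrightarrow> false_entry s (fml_code \<psi>) v"
      using clauses[OF le le, of w] Dia.prems(1,3) by (simp add: W_def)
    then have "\<not> sat R V v \<psi>" if "(w, v) \<in> R" for v
      using Dia.IH[OF _ le, of v] that subsetD[OF R that] by (simp add: R_def)
    then show ?case by auto
  next
    case (Box \<psi>)
    then have le: "fml_code \<psi> \<le> e" using subformula_code_le(6)[of \<psi>] by linarith
    then have "\<exists>v<N. path_entry s 1 w v \<and> false_entry s (fml_code \<psi>) v"
      using clauses[OF le le, of w] Box.prems(1,3) by (simp add: W_def)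
    then obtain v where v: "v < N" "path_entry s 1 w v" "false_entry s (fml_code \<psi>) v" by blast
    then have wv: "(w, v) \<in> R" using Box.prems(3) by (simp add: R_def W_def)
    then have "v \<in> W" using R by blast
    then show ?case using Box.IH[OF v(3) le] wv by auto
  qed
  then have "\<not> sat R V w \<phi>" using w by (simp add: e_def)
  then show False using logic_sound[OF \<open>\<phi> \<in> logic P\<close> model w(1)] ..
qed

lemma refutation_table_exists:
  assumes m: "is_model P W R V" and W: "W \<subseteq> {..<N}" and w: "w \<in> W" and false: "\<not> sat R V w \<phi>"
    and fin: "finite P"
  obtains s where "s < table_bound (qdps_code P) (fml_code \<phi>) N"
    and "refutation_table (qdps_code P) (fml_code \<phi>) N s"
proof -
  define c where "c = qdps_code P"
  define e where "e = fml_code \<phi>"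
  \<comment> \<open>Lengths run up to \<open>Suc c\<close> because for empty \<open>P\<close> the
    code \<open>c\<close> is 0, and the edges, of length 1, must still be listed.\<close>
  define paths where "paths = {prod_encode (0, prod_encode (l, prod_encode (x, y))) | l x y.
    l \<le> Suc c \<and> x \<in> W \<and> y \<in> W \<and> (x, y) \<in> R ^^ l}"
  \<comment> \<open>Only codes of formulae are listed, so that a listed number determines a formula
    and its tag the outermost constructor.\<close>
  define falses where "falses = {prod_encode (1, prod_encode (fml_code \<psi>, v)) | \<psi> v.
    fml_code \<psi> \<le> e \<and> v \<in> W \<and> \<not> sat R V v \<psi>}"
  define s where "s = set_encode (paths \<union> falses)"
  let ?b = "prod_encode (1, prod_encode (Suc (c + e), prod_encode (N, N)))"
  have R: "R \<subseteq> W \<times> W" using m by (simp add: is_model_def)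
  have "paths \<union> falses \<subseteq> {..<Suc ?b}"
  proof
    fix i assume "i \<in> paths \<union> falses"
    then show "i \<in> {..<Suc ?b}"
    proof
      assume "i \<in> paths"
      then obtain l x y where i: "i = prod_encode (0, prod_encode (l, prod_encode (x, y)))"
        and "l \<le> Suc c" "x \<in> W" "y \<in> W" by (auto simp: paths_def)
      then have "l \<le> Suc (c + e)" "x \<le> N" "y \<le> N" using W by (auto intro: less_imp_le)
      then have "i \<le> ?b" unfolding i by (intro prod_encode_mono) simp_all
      then show ?thesis by simp
    next
      assume "i \<in> falses"
      then obtain \<psi> v where i: "i = prod_encode (1, prod_encode (fml_code \<psi>, v))"
        and "fml_code \<psi> \<le> e" "v \<in> W" by (auto simp: falses_def)
      moreover from this have "v \<le> prod_encode (N, N)"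
        using W le_prod_encode_1[of N N] by fastforce
      ultimately have "i \<le> ?b" unfolding i by (intro prod_encode_mono) simp_all
      then show ?thesis by simp
    qed
  qed
  then have bound: "s < table_bound c e N" and "finite (paths \<union> falses)"
    unfolding s_def table_bound_def by (rule set_encode_less, rule finite_subset) simp
  then have decode: "set_decode s = paths \<union> falses" by (simp add: s_def)
  have path: "path_entry s l x y \<longleftrightarrow> l \<le> Suc c \<and> x \<in> W \<and> y \<in> W \<and> (x, y) \<in> R ^^ l" for l x y
    unfolding path_entry_def decode by (auto simp: paths_def falses_def)
  have false_iff: "false_entry s k v \<longleftrightarrow> (\<exists>\<psi>. k = fml_code \<psi> \<and> k \<le> e \<and> v \<in> W \<and> \<not> sat R V v \<psi>)" for k v
    unfolding false_entry_def decode by (auto simp: paths_def falses_def)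
  have edge: "path_entry s 1 x y \<longleftrightarrow> (x, y) \<in> R" for x y using R by (auto simp: path)
  have "refutation_table c e N s"
    unfolding refutation_table_def
  proof (intro conjI allI impI)
    fix x y assume "path_entry s 0 x y"
    then show "x = y" by (simp add: path)
  next
    fix x y assume "path_entry s 1 x y"
    then show "path_entry s 0 x x" "path_entry s 0 y y" by (simp_all add: path)
  next
    fix l x y assume "l < c" "x < N" "y < N"
    have "path_entry s (Suc l) x y \<longleftrightarrow> x \<in> W \<and> y \<in> W \<and> (\<exists>z. (x, z) \<in> R ^^ l \<and> (z, y) \<in> R)"
      using \<open>l < c\<close> by (auto simp: path)
    also have "\<dots> \<longleftrightarrow> (\<exists>z<N. path_entry s l x z \<and> path_entry s 1 z y)"
      unfolding edge using R W \<open>l < c\<close> by (auto simp: path)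
    finally show "path_entry s (Suc l) x y \<longleftrightarrow> (\<exists>z<N. path_entry s l x z \<and> path_entry s 1 z y)" .
  next
    fix k n x y
    assume kn: "k < c" "n < c" "prod_encode (k, n) \<in> set_decode c" and "path_entry s k x y"
    then have xy: "x \<in> W" "y \<in> W" "(x, y) \<in> R ^^ k" by (simp_all add: path)
    have "(k, n) \<in> P" using kn(3) fin by (auto simp: c_def qdps_code_def)
    then have "(x, y) \<in> R ^^ n" using m xy unfolding is_model_def satisfies_qdp_def by fastforce
    then show "path_entry s n x y" using xy kn by (simp add: path)
  next
    fix a b v
    assume "false_entry s (prod_encode (1, a)) v"
    then obtain \<psi> where \<psi>: "prod_encode (1, a) = fml_code \<psi>" "v \<in> W" "\<not> sat R V v \<psi>"
      unfolding false_iff by blast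
    then have "v \<in> V a" by (cases \<psi>) auto
    then have "sat R V v \<chi>" if "prod_encode (0, a) = fml_code \<chi>" for \<chi>
      using that by (cases \<chi>) auto
    then show "\<not> false_entry s (prod_encode (0, a)) v" unfolding false_iff by blast
  next
    fix a b v
    assume "false_entry s (prod_encode (2, prod_encode (a, b))) v"
    then obtain \<psi> where \<psi>: "prod_encode (2, prod_encode (a, b)) = fml_code \<psi>"
        "fml_code \<psi> \<le> e" "v \<in> W" "\<not> sat R V v \<psi>"
      unfolding false_iff by metis
    then obtain \<psi>1 \<psi>2 where "\<psi> = Or \<psi>1 \<psi>2" "a = fml_code \<psi>1" "b = fml_code \<psi>2"
      by (cases \<psi>) auto
    then show "false_entry s a v" "false_entry s b v"
      using \<psi>(2-) subformula_code_le(1)[of \<psi>1 \<psi>2] subformula_code_le(2)[of \<psi>2 \<psi>1]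
      unfolding false_iff by (auto simp del: fml_code.simps intro: le_trans)
  next
    fix a b v
    assume "false_entry s (prod_encode (3, prod_encode (a, b))) v"
    then obtain \<psi> where \<psi>: "prod_encode (3, prod_encode (a, b)) = fml_code \<psi>"
        "fml_code \<psi> \<le> e" "v \<in> W" "\<not> sat R V v \<psi>"
      unfolding false_iff by metis
    then obtain \<psi>1 \<psi>2 where "\<psi> = And \<psi>1 \<psi>2" "a = fml_code \<psi>1" "b = fml_code \<psi>2"
      by (cases \<psi>) auto
    then show "false_entry s a v \<or> false_entry s b v"
      using \<psi>(2-) subformula_code_le(3)[of \<psi>1 \<psi>2] subformula_code_le(4)[of \<psi>2 \<psi>1]
      unfolding false_iff by (auto simp del: fml_code.simps intro: le_trans)
  next
    fix a b v u
    assume "false_entry s (prod_encode (4, a)) v" and edge': "path_entry s 1 v u"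
    then obtain \<psi> where \<psi>: "prod_encode (4, a) = fml_code \<psi>"
        "fml_code \<psi> \<le> e" "v \<in> W" "\<not> sat R V v \<psi>"
      unfolding false_iff by metis
    then obtain \<psi>' where "\<psi> = Dia \<psi>'" "a = fml_code \<psi>'" by (cases \<psi>) auto
    then show "false_entry s a u"
      using \<psi>(2-) subformula_code_le(5)[of \<psi>'] edge' R
      unfolding false_iff edge by (auto simp del: fml_code.simps)
  next
    fix a b v
    assume "false_entry s (prod_encode (5, a)) v"
    then obtain \<psi> where \<psi>: "prod_encode (5, a) = fml_code \<psi>"
        "fml_code \<psi> \<le> e" "v \<in> W" "\<not> sat R V v \<psi>"
      unfolding false_iff by metis
    then obtain \<psi>' where \<psi>': "\<psi> = Box \<psi>'" "a = fml_code \<psi>'" by (cases \<psi>) auto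
    with \<psi> obtain u where u: "(v, u) \<in> R" "\<not> sat R V u \<psi>'" by auto
    then have "false_entry s a u"
      using \<psi>(2) \<psi>' subformula_code_le(6)[of \<psi>'] R
      unfolding false_iff by (auto simp del: fml_code.simps)
    then show "\<exists>u<N. path_entry s 1 v u \<and> false_entry s a u"
      using u(1) R W unfolding edge by blast
  next
    have "path_entry s 0 w w" "false_entry s e w"
      using w false by (auto simp: path false_iff e_def)
    then show "\<exists>w<N. path_entry s 0 w w \<and> false_entry s e w" using w W by blast
  qed
  with bound show thesis by (intro that[of s]) (simp_all add: c_def e_def)
qed

section \<open>Reduction of validity to a bounded search, and computability of the search\<close>

lemma in_logic_iff_not_refutable:
  assumes "finite P" and "\<forall>q\<in>P. is_qdp q"
  shows "\<phi> \<in> logic P \<longleftrightarrow> \<not> refutable (qdps_code P) (fml_code \<phi>)"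
proof (rule iffI; rule ccontr)
  assume "\<phi> \<in> logic P" and "\<not> \<not> refutable (qdps_code P) (fml_code \<phi>)"
  then show False
    using refutation_table_imp_not_in_logic assms(1) unfolding refutable_def by blast
next
  assume not_refutable: "\<not> refutable (qdps_code P) (fml_code \<phi>)" and "\<phi> \<notin> logic P"
  then obtain W :: "nat set" and R V w where m: "is_model P W R V" "w \<in> W" "\<not> sat R V w \<phi>"
    by (auto simp: logic_def valid_over_def)
  have "atoms \<phi> \<subseteq> {..<Suc (fml_code \<phi>)}" using atoms_le_code by (auto simp: less_Suc_eq_le)
  with m assms(2) modal_depth_le_code obtain W' R' V' w' where m': "is_model P W' R' V'"
      "W' \<subseteq> {..<world_bound (Suc (fml_code \<phi>)) (fml_code \<phi>)}" "w' \<in> W'" "\<not> sat R' V' w' \<phi>"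
    by (rule finite_countermodel)
  from m' assms(1) obtain s where
    "s < table_bound (qdps_code P) (fml_code \<phi>) (world_bound (Suc (fml_code \<phi>)) (fml_code \<phi>))"
    "refutation_table (qdps_code P) (fml_code \<phi>) (world_bound (Suc (fml_code \<phi>)) (fml_code \<phi>)) s"
    by (rule refutation_table_exists)
  then show False using not_refutable unfolding refutable_def by blast
qed

lemma computable_world_bound:
  assumes "computable n A" and "computable n B"
  shows "computable n (\<lambda>xs. world_bound (A xs) (B xs))"
proof -
  have "type_bound a d = rec_nat (2 ^ a) (\<lambda>_ v. Suc (prod_encode (2 ^ a, 2 ^ v))) d" for a d
    by (induction d) simp_all
  then show ?thesis
    unfolding world_bound_def
    by (simp only:) (intro computable_rec_nat computable_intros assms
      assms(1)[THEN computable_tl, THEN computable_tl])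
qed

text \<open>All quantifiers in the unfolded definitions are bounded by computable terms, so the
  closure rules apply along the syntax.\<close>

lemma decidable_refutable: "decidable (Suc (Suc 0)) (\<lambda>xs. refutable (hd xs) (hd (tl xs)))"
  unfolding refutable_def refutation_table_def path_entry_def false_entry_def table_bound_def
  by (intro decidable_intros computable_world_bound computable_intros)

theorem theorem2p3:
  shows "\<exists>f :: nat \<Rightarrow> nat \<Rightarrow> nat. computable2 f \<and>
    (\<forall>(P :: qdp set) (\<phi> :: fml). finite P \<and> (\<forall>q\<in>P. is_qdp q) \<longrightarrow>
       (\<phi> \<in> logic P \<longrightarrow> f (qdps_code P) (fml_code \<phi>) = 1) \<and>
       (\<phi> \<notin> logic P \<longrightarrow> f (qdps_code P) (fml_code \<phi>) = 0))"
proof (intro exI conjI)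
  obtain r where r: "\<And>xs. length xs = Suc (Suc 0) \<Longrightarrow>
      evaluates r xs (of_bool (\<not> refutable (hd xs) (hd (tl xs))))"
    using decidable_not[OF decidable_refutable] unfolding decidable_def computable_def by blast
  have "evaluates r [x, y] (of_bool (\<not> refutable x y))" for x y
    using r[of "[x, y]"] by simp
  \<comment> \<open>The function is total: \<open>refutable\<close> is defined on all numbers,
    including those that code no formula.\<close>
  then show "computable2 (\<lambda>x y. of_bool (\<not> refutable x y))"
    unfolding computable2_def by blast
qed (simp add: in_logic_iff_not_refutable)

end
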